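(* Let $(p^*,E)$ be an isostatic pinned framework in $\mathbb{R}^d$ with $n$ vertices and $m$ edges, with length and pinning functions $f_1,\dots,f_{m+D}$, $D=d(d+1)/2$, $m+D=nd$. Suppose that the gradients $\{\nabla f_i(p^* )\}_{i=2}^{m+D}$ are linearly independent. Suppose there is an analytic path $p(t)$ in $\mathbb{R}^{nd}$, defined for $t$ near $0$, with $p(0)=p^*$ and $p'(0)\neq 0$, satisfying $$f_i(p(t))=f_i(p^* )\qquad\text{for all } i=2,\dots,m+D,$$ and such that $f_1(p(t))-f_1(p^* )=a_3t^3+o(t^3)$ in a neighborhood of $t=0$, for some $a_3\in\mathbb{R}$. Then the framework $(p^*,E)$ is not second-order rigid. Furthermore, if $a_3\neq 0$, then the framework is third-order rigid.
   Context: A bar framework $(p,E)$ in $\mathbb{R}^d$ consists of vertex positions $p=(p_1,\dots,p_n)\in\mathbb{R}^{nd}$, $p_i\in\mathbb{R}^d$, and edges $E=\{E_1,\dots,E_m\}$, each joining two distinct vertices; the endpoints of $E_i$ are denoted $p_{i,1},p_{i,2}$. The length functions are $f_i(p)=|p_{i,1}-p_{i,2}|^2$, $i=1,\dots,m$. The framework is isostatic if $m+D=nd$ with $D=\frac{d(d+1)}{2}$. Pinning: the vertices are assumed labelled so that $p^*_1,\dots,p^*_{d+1}$ are affinely independent (in particular the vertices affinely span $\mathbb{R}^d$), and $D$ coordinates are pinned at zero: $p_1$ is at the origin, and for $2\le i\le d$ the vertex $p_i$ lies in the span of the first $i-1$ coordinate vectors. Each of these $D$ coordinates gives a linear pinning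 function (the corresponding coordinate function on $\mathbb{R}^{nd}$), and these are denoted $f_{m+1},\dots,f_{m+D}$; the pinned framework satisfies $f_{m+j}(p^* )=0$ for $j=1,\dots,D$. The rigidity matrix $R(p)\in\mathbb{R}^{m\times nd}$ has $i$th row $\nabla f_i(p)$, $i=1,\dots,m$, and $R(v)$ is the same matrix evaluated at $v$. The trivial flexes are $\mathcal{T}(p)=\{v: v_i=Ap_i+b,\ A \text{ skew-symmetric},\ b\in\mathbb{R}^d\}$. The framework is second-order rigid if there are no $v,a\in\mathbb{R}^{nd}$ with $v\notin\mathcal{T}(p)$, $R(p)v=0$ and $R(p)a=-R(v)v$. A $(1,k)$-flex of the pinned framework $(p,E)$ is an analytic trajectory $p(t)$ such that $p(0)=p$, $p'(0)\ne0$, and $\frac{d^j}{dt^j}f_i(p(t))\big|_{t=0}=0$ for $j=1,\dots,k$ and all $i=1,\dots,m+D$. Let $K(p)=\{v\in\mathbb{R}^{nd}:\nabla f_i(p)v=0\text{ for all } i=1,\dots,m+D\}$. When $\dim K(p)=1$, the framework is said to be third-order rigid (rigidity order $3$) if the pinned framework has a $(1,2)$-flex but no $(1,3)$-flex. *)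

theory Defs
  imports "HOL-Analysis.Analysis" "HOL-Library.Landau_Symbols"
begin

text \<open>
  A configuration of the vertices \<open>'n\<close> in the space with coordinates \<open>'d\<close>, i.e. a point of
  the Euclidean space of dimension \<open>n * d\<close>, where \<open>n = CARD('n)\<close> and \<open>d = CARD('d)\<close>.
  Edges are a list of pairs; the edge \<open>E\<^sub>i\<close> is \<open>E ! (i - 1)\<close>.
\<close>

type_synonym ('n, 'd) config = "((real, 'd) vec, 'n) vec"

definition gradient :: "('a::real_inner \<Rightarrow> real) \<Rightarrow> 'a \<Rightarrow> 'a" where
  "gradient f x = (THE g. GDERIV f x :> g)"

text \<open>Each edge joins two distinct vertices, and no edge is listed twice in either orientation.\<close>

definition edge_list :: "('n \<times> 'n) list \<Rightarrow> bool" where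
  "edge_list E \<longleftrightarrow> (\<forall>(a, b) \<in> set E. a \<noteq> b) \<and> distinct (map (\<lambda>(a, b). {a, b}) E)"

definition edge_length_sq :: "'n::finite \<times> 'n \<Rightarrow> ('n, 'd::finite) config \<Rightarrow> real" where
  "edge_length_sq e x = (norm (x $ fst e - x $ snd e))\<^sup>2"

definition D_of :: "nat \<Rightarrow> nat" where
  "D_of d = d * (d + 1) div 2"

text \<open>
  The pinned coordinates: \<open>(i, j)\<close> stands for the \<open>j\<close>-th coordinate of the vertex \<open>p\<^sub>i\<close>. For
  \<open>1 \<le> i \<le> d\<close> the vertex \<open>p\<^sub>i\<close> is confined to the span of the first \<open>i - 1\<close> coordinate
  vectors, so its coordinates \<open>i, \<dots>, d\<close> are pinned (all of them for \<open>i = 1\<close>).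
\<close>

definition pinned_coords :: "nat \<Rightarrow> (nat \<times> nat) list" where
  "pinned_coords d = concat (map (\<lambda>i. map (\<lambda>j. (i, j)) [i..<Suc d]) [1..<Suc d])"

lemma set_pinned_coords: "set (pinned_coords d) = {(i, j). 1 \<le> i \<and> i \<le> j \<and> j \<le> d}"
  by (force simp: pinned_coords_def simp del: upt_Suc)

lemma length_pinned_coords: "length (pinned_coords d) = D_of d"
proof -
  have "length (pinned_coords d) = (\<Sum>i\<leftarrow>[1..<Suc d]. Suc d - i)"
    by (simp add: pinned_coords_def length_concat comp_def del: upt_Suc)
  also have "\<dots> = (\<Sum>i = 1..d. Suc d - i)"
    by (metis interv_sum_list_conv_sum_set_nat atLeastLessThanSuc_atLeastAtMost set_upt)
  also have "\<dots> = (\<Sum>i = 1..d. i)"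
    by (rule sum.reindex_bij_witness[of _ "\<lambda>i. Suc d - i" "\<lambda>i. Suc d - i"]) auto
  also have "\<dots> = D_of d"
    by (simp add: D_of_def Sum_Icc_nat)
  finally show ?thesis .
qed

text \<open>
  The functions \<open>f\<^sub>1, \<dots>, f\<^sub>m\<close> (squared edge lengths) and \<open>f\<^sub>m\<^sub>+\<^sub>1, \<dots>, f\<^sub>m\<^sub>+\<^sub>D\<close> (pinned coordinates).
  The labelling of vertices and coordinates by \<open>1, 2, \<dots>\<close> is given by \<open>vtx\<close> and \<open>crd\<close>.
\<close>

definition ffun :: "('n::finite \<times> 'n) list \<Rightarrow> (nat \<Rightarrow> 'n) \<Rightarrow> (nat \<Rightarrow> 'd::finite) \<Rightarrow> nat
    \<Rightarrow> ('n, 'd) config \<Rightarrow> real" where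
  "ffun E vtx crd i x =
    (if i \<le> length E then edge_length_sq (E ! (i - 1)) x
     else case pinned_coords CARD('d) ! (i - length E - 1) of (a, b) \<Rightarrow> x $ vtx a $ crd b)"

definition isostatic :: "('n::finite \<times> 'n) list \<Rightarrow> ('n, 'd::finite) config \<Rightarrow> bool" where
  "isostatic E p \<longleftrightarrow> length E + D_of CARD('d) = CARD('n) * CARD('d)"

definition pinned_framework :: "('n::finite \<times> 'n) list \<Rightarrow> (nat \<Rightarrow> 'n) \<Rightarrow> (nat \<Rightarrow> 'd::finite)
    \<Rightarrow> ('n, 'd) config \<Rightarrow> bool" where
  "pinned_framework E vtx crd p \<longleftrightarrow>
     edge_list E \<and>
     bij_betw vtx {1..CARD('n)} UNIV \<and> bij_betw crd {1..CARD('d)} UNIV \<and>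
     CARD('d) + 1 \<le> CARD('n) \<and>
     inj_on (\<lambda>i. p $ vtx i) {1..CARD('d) + 1} \<and>
     \<not> affine_dependent ((\<lambda>i. p $ vtx i) ` {1..CARD('d) + 1}) \<and>
     (\<forall>j\<in>{1..D_of CARD('d)}. ffun E vtx crd (length E + j) p = 0)"

text \<open>
  \<open>rigidity_row E x i\<close> is the \<open>i\<close>-th row of the rigidity matrix \<open>R(x)\<close>, so that the \<open>i\<close>-th
  entry of \<open>R(x) v\<close> is \<open>rigidity_row E x i \<bullet> v\<close>.
\<close>

definition rigidity_row :: "('n::finite \<times> 'n) list \<Rightarrow> ('n, 'd::finite) config \<Rightarrow> nat
    \<Rightarrow> ('n, 'd) config" where
  "rigidity_row E x i = gradient (edge_length_sq (E ! (i - 1))) x"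

definition trivial_flexes :: "('n::finite, 'd::finite) config \<Rightarrow> ('n, 'd) config set" where
  "trivial_flexes p =
     {v. \<exists>(A :: real^'d^'d) b. transpose A = - A \<and> (\<forall>i. v $ i = A *v (p $ i) + b)}"

definition second_order_rigid :: "('n::finite \<times> 'n) list \<Rightarrow> ('n, 'd::finite) config \<Rightarrow> bool" where
  "second_order_rigid E p \<longleftrightarrow>
     \<not> (\<exists>v a. v \<notin> trivial_flexes p \<and>
          (\<forall>i\<in>{1..length E}. rigidity_row E p i \<bullet> v = 0) \<and>
          (\<forall>i\<in>{1..length E}. rigidity_row E p i \<bullet> a = - (rigidity_row E v i \<bullet> v)))"

definition real_analytic_on :: "real set \<Rightarrow> (real \<Rightarrow> 'a::real_normed_vector) \<Rightarrow> bool" where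
  "real_analytic_on S q \<longleftrightarrow>
     (\<forall>s\<in>S. \<exists>r>0. \<exists>c. \<forall>t. \<bar>t - s\<bar> < r \<longrightarrow> (\<lambda>k::nat. (t - s) ^ k *\<^sub>R c k) sums q t)"

text \<open>
  A trajectory defined near \<open>0\<close> is a total function of which only the values on some interval
  around \<open>0\<close> matter.
\<close>

definition flex_1k :: "('n::finite \<times> 'n) list \<Rightarrow> (nat \<Rightarrow> 'n) \<Rightarrow> (nat \<Rightarrow> 'd::finite)
    \<Rightarrow> ('n, 'd) config \<Rightarrow> nat \<Rightarrow> (real \<Rightarrow> ('n, 'd) config) \<Rightarrow> bool" where
  "flex_1k E vtx crd p k q \<longleftrightarrow>
     (\<exists>\<epsilon>>0. real_analytic_on {-\<epsilon><..<\<epsilon>} q) \<and> q 0 = p \<and>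
     vector_derivative q (at 0) \<noteq> 0 \<and>
     (\<forall>j\<in>{1..k}. \<forall>i\<in>{1..length E + D_of CARD('d)}.
        (deriv ^^ j) (\<lambda>t. ffun E vtx crd i (q t)) 0 = 0)"

definition Kspace :: "('n::finite \<times> 'n) list \<Rightarrow> (nat \<Rightarrow> 'n) \<Rightarrow> (nat \<Rightarrow> 'd::finite)
    \<Rightarrow> ('n, 'd) config \<Rightarrow> ('n, 'd) config set" where
  "Kspace E vtx crd p =
     {v. \<forall>i\<in>{1..length E + D_of CARD('d)}. gradient (ffun E vtx crd i) p \<bullet> v = 0}"

text \<open>The notion is only defined for \<open>dim K = 1\<close>, which is therefore part of the definition.\<close>

definition third_order_rigid :: "('n::finite \<times> 'n) list \<Rightarrow> (nat \<Rightarrow> 'n) \<Rightarrow> (nat \<Rightarrow> 'd::finite)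
    \<Rightarrow> ('n, 'd) config \<Rightarrow> bool" where
  "third_order_rigid E vtx crd p \<longleftrightarrow>
     dim (Kspace E vtx crd p) = 1 \<and>
     (\<exists>q. flex_1k E vtx crd p 2 q) \<and> \<not> (\<exists>q. flex_1k E vtx crd p 3 q)"

end

theory Submission
  imports Defs
begin

text \<open>
  Every \<open>f\<^sub>i\<close> is a polynomial of degree at most two, so along a curve
  \<open>q(t) = p + t c\<^sub>1 + t\<^sup>2 c\<^sub>2 + t\<^sup>3 c\<^sub>3 + \<dots>\<close> the function \<open>f\<^sub>i(q(t)) - f\<^sub>i(p)\<close> has the coefficients
  \<open>g\<^sub>i \<bullet> c\<^sub>1\<close>, \<open>g\<^sub>i \<bullet> c\<^sub>2 + Q\<^sub>i(c\<^sub>1, c\<^sub>1)\<close> and \<open>g\<^sub>i \<bullet> c\<^sub>3 + 2 Q\<^sub>i(c\<^sub>1, c\<^sub>2)\<close>, where \<open>g\<^sub>i = \<nabla>f\<^sub>i(p)\<close> and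
  \<open>Q\<^sub>i\<close> is the symmetric bilinear form of the quadratic part of \<open>f\<^sub>i\<close> (\<open>ffun_along_curve\<close>). For
  the given path these are \<open>0\<close>, \<open>0\<close> and \<open>a\<^sub>3 \<delta>\<^sub>i\<^sub>1\<close>, for \<open>i = 1\<close> because a power series that is
  \<open>o(t\<^sup>3)\<close> has no terms up to order three.

  The equations of order one and two say that \<open>v = c\<^sub>1\<close> and \<open>a = 2 c\<^sub>2\<close> satisfy \<open>R(p) v = 0\<close> and
  \<open>R(p) a = - R(v) v\<close>. Since \<open>v\<close> is nonzero and respects the pins, it is not a trivial flex
  (\<open>pinned_trivial_flex_eq_0\<close>), and second-order rigidity fails.

  For third-order rigidity, \<open>nd - 1\<close> independent gradients leave only a line of common zeros,
  which is \<open>\<real> c\<^sub>1\<close> (\<open>orthogonal_complement_eq_span\<close>). It is also \<open>K(p)\<close>, as \<open>g\<^sub>1 \<bullet> c\<^sub>1 = 0\<close>. The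
  path \<open>q\<close> is a \<open>(1,2)\<close>-flex. A \<open>(1,3)\<close>-flex \<open>r\<close> has \<open>r'(0) = l c\<^sub>1\<close> with \<open>l \<noteq> 0\<close>, and its
  second-order term differs from \<open>l\<^sup>2 c\<^sub>2\<close> by a multiple \<open>m c\<^sub>1\<close>, because both solve the same linear
  system. So \<open>r\<close> agrees up to order two with the reparametrised path \<open>q(l t + m t\<^sup>2)\<close>. Let \<open>y\<close> be
  the difference of their terms of order three. The lengths are stationary to third order along
  \<open>r\<close>, but along the reparametrised path \<open>f\<^sub>1\<close> moves by \<open>a\<^sub>3 l\<^sup>3 t\<^sup>3\<close>, so
  \<open>g\<^sub>i \<bullet> y = - l\<^sup>3 a\<^sub>3 \<delta>\<^sub>i\<^sub>1\<close>. Hence \<open>y\<close> lies on the line \<open>\<real> c\<^sub>1\<close>, which \<open>g\<^sub>1\<close> annihilates as well, and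
  \<open>l\<^sup>3 a\<^sub>3 = 0\<close>.
\<close>

section \<open>Power series of functions and curves\<close>

lemma fps_expansion_at_0:
  assumes "f has_fps_expansion F"
  shows "f 0 = fps_nth F 0"
  using assms eventually_nhds_x_imp_x
  by (fastforce simp: has_fps_expansion_def eval_fps_at_0)

lemma higher_deriv_fps_expansion:
  fixes f :: "'a::{banach,real_normed_field} \<Rightarrow> 'a"
  assumes "f has_fps_expansion F"
  shows "(deriv ^^ k) f 0 = fact k * fps_nth F k"
  using assms
proof (induction k arbitrary: f F)
  case 0
  then show ?case by (simp add: fps_expansion_at_0)
next
  case (Suc k)
  have "(deriv ^^ Suc k) f 0 = (deriv ^^ k) (deriv f) 0"
    by (simp only: funpow_Suc_right o_apply)
  also have "\<dots> = fact k * fps_nth (fps_deriv F) k"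
    by (rule Suc.IH[OF has_fps_expansion_deriv[OF Suc.prems]])
  finally show ?case by (simp add: algebra_simps)
qed

lemma fps_expansion_has_derivative_at_0:
  fixes f :: "'a::{banach,real_normed_field} \<Rightarrow> 'a"
  assumes "f has_fps_expansion F"
  shows "(f has_field_derivative fps_nth F 1) (at 0)"
proof -
  have R: "fps_conv_radius F > 0" and ev: "eventually (\<lambda>z. eval_fps F z = f z) (nhds 0)"
    using assms by (auto simp: has_fps_expansion_def)
  have "(eval_fps F has_field_derivative eval_fps (fps_deriv F) 0) (at 0)"
    using R by (intro has_field_derivative_eval_fps) (auto simp: zero_ereal_def)
  then show ?thesis
    using DERIV_cong_ev[OF refl ev refl] by (simp add: eval_fps_at_0)
qed

text \<open>
  Dividing by \<open>t ^ d\<close>, where \<open>d\<close> is the order of the series, leaves a function that tends to the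
  leading coefficient at \<open>0\<close>. If \<open>d \<le> n\<close>, the quotient also tends to \<open>0\<close>.
\<close>

lemma fps_nth_eq_0_if_smallo:
  fixes h :: "real \<Rightarrow> real"
  assumes "h has_fps_expansion H" "h \<in> o[at 0](\<lambda>t. t ^ n)" "k \<le> n"
  shows "fps_nth H k = 0"
proof (rule ccontr)
  assume "fps_nth H k \<noteq> 0"
  define d where "d = subdegree H"
  have "d \<le> n"
    using subdegree_leI[OF \<open>fps_nth H k \<noteq> 0\<close>] assms(3) by (simp add: d_def)
  have nz: "fps_nth H d \<noteq> 0"
    using \<open>fps_nth H k \<noteq> 0\<close> unfolding d_def by (intro nth_subdegree_nonzero) auto
  have R: "fps_conv_radius H > 0" and ev: "eventually (\<lambda>z. eval_fps H z = h z) (nhds 0)"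
    using assms(1) by (auto simp: has_fps_expansion_def)
  have ev_at: "eventually (\<lambda>z. h z / z ^ d = eval_fps (fps_shift d H) z) (at 0)"
  proof -
    have "eventually (\<lambda>z. z \<in> eball 0 (fps_conv_radius H)) (nhds 0)"
      using R by (intro eventually_nhds_in_open) (auto simp: zero_ereal_def)
    with ev have "eventually (\<lambda>z. z \<noteq> 0 \<longrightarrow> h z / z ^ d = eval_fps (fps_shift d H) z) (nhds 0)"
      by eventually_elim (subst eval_fps_shift, auto simp: d_def)
    then show ?thesis by (simp add: eventually_at_filter)
  qed
  have "(eval_fps (fps_shift d H) \<longlongrightarrow> eval_fps (fps_shift d H) 0) (at 0)"
  proof -
    have "isCont (eval_fps (fps_shift d H)) 0"
      using R by (intro continuous_eval_fps) (auto simp: zero_ereal_def)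
    then show ?thesis by (simp add: isCont_def)
  qed
  then have "((\<lambda>z. h z / z ^ d) \<longlongrightarrow> fps_nth H d) (at 0)"
    using tendsto_cong[OF ev_at] by (simp add: eval_fps_at_0)
  moreover have "((\<lambda>z. h z / z ^ d) \<longlongrightarrow> 0) (at 0)"
  proof -
    have "(\<lambda>t::real. t ^ n) \<in> O[at 0](\<lambda>t. t ^ d)"
    proof (rule bigoI[where c = 1])
      have "eventually (\<lambda>x::real. x \<in> ball 0 1) (at 0)"
        by (intro eventually_at_in_open') auto
      then show "\<forall>\<^sub>F x::real in at 0. norm (x ^ n) \<le> 1 * norm (x ^ d)"
        by eventually_elim (auto simp: power_abs intro!: power_decreasing \<open>d \<le> n\<close>)
    qed
    with assms(2) have "h \<in> o[at 0](\<lambda>t. t ^ d)"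
      by (rule landau_o.small_big_trans)
    then show ?thesis by (rule smalloD_tendsto)
  qed
  ultimately show False
    using nz tendsto_unique[of "at (0::real)"] by auto
qed

text \<open>
  The counterpart of \<^const>\<open>has_fps_expansion\<close> for curves: coefficients of a formal power series
  are ring elements, so those of a curve in a vector space are kept as a plain sequence.
\<close>

definition curve_series :: "(real \<Rightarrow> 'a::real_normed_vector) \<Rightarrow> (nat \<Rightarrow> 'a) \<Rightarrow> bool" where
  "curve_series q c \<longleftrightarrow> (\<forall>\<^sub>F t in nhds 0. (\<lambda>k. t ^ k *\<^sub>R c k) sums q t)"

lemma real_analytic_on_curve_series:
  assumes "real_analytic_on S q" "0 \<in> S"
  obtains c where "curve_series q c"
proof -
  obtain r c where "r > 0" and *: "\<And>t. \<bar>t\<bar> < r \<Longrightarrow> (\<lambda>k. t ^ k *\<^sub>R c k) sums q t"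
    using assms unfolding real_analytic_on_def by fastforce
  have "\<forall>\<^sub>F t::real in nhds 0. t \<in> ball 0 r"
    using \<open>r > 0\<close> by (intro eventually_nhds_in_open) auto
  then have "curve_series q c"
    unfolding curve_series_def by eventually_elim (simp add: *)
  then show thesis by (rule that)
qed

lemma curve_series_bounded_linear:
  assumes "bounded_linear L" "curve_series q c"
  shows "curve_series (\<lambda>t. L (q t)) (\<lambda>k. L (c k))"
  using assms(2) unfolding curve_series_def
  by eventually_elim (use bounded_linear.sums[OF assms(1)] in
      \<open>fastforce simp: linear_cmul[OF bounded_linear.linear[OF assms(1)]]\<close>)

lemma curve_series_imp_fps_expansion:
  assumes "curve_series f c"
  shows "f has_fps_expansion Abs_fps c"
  using assms unfolding curve_series_def
  by (intro has_fps_expansionI) (simp add: mult.commute)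

lemma curve_series_inner_self:
  fixes q :: "real \<Rightarrow> 'a::euclidean_space"
  assumes "curve_series q c"
  shows "(\<lambda>t. q t \<bullet> q t) has_fps_expansion Abs_fps (\<lambda>k. \<Sum>i\<le>k. c i \<bullet> c (k - i))"
proof -
  have "(\<lambda>t. q t \<bullet> b) has_fps_expansion Abs_fps (\<lambda>k. c k \<bullet> b)" for b
    using curve_series_bounded_linear[OF bounded_linear_inner_left assms]
    by (rule curve_series_imp_fps_expansion)
  then have "(\<lambda>t. \<Sum>b\<in>Basis. (q t \<bullet> b) * (q t \<bullet> b)) has_fps_expansion
      (\<Sum>b\<in>Basis. Abs_fps (\<lambda>k. c k \<bullet> b) * Abs_fps (\<lambda>k. c k \<bullet> b))"
    by (intro fps_expansion_intros)
  also have "(\<Sum>b\<in>Basis. Abs_fps (\<lambda>k. c k \<bullet> b) * Abs_fps (\<lambda>k. c k \<bullet> b)) =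
      Abs_fps (\<lambda>k. \<Sum>i\<le>k. c i \<bullet> c (k - i))"
    by (rule fps_ext)
      (simp add: fps_sum_nth fps_mult_nth atLeast0AtMost, subst sum.swap,
        simp add: euclidean_inner[symmetric])
  finally show ?thesis by (simp add: euclidean_inner[symmetric])
qed

lemma curve_series_at_0:
  assumes "curve_series q c"
  shows "q 0 = c 0"
proof -
  have "(\<lambda>k. 0 ^ k *\<^sub>R c k) sums q 0"
    using assms eventually_nhds_x_imp_x unfolding curve_series_def by fastforce
  moreover have "(\<lambda>k. 0 ^ k *\<^sub>R c k) = (\<lambda>k. if k = 0 then c k else 0)"
    by auto
  ultimately show ?thesis
    using sums_unique2 sums_single[of 0 c] by metis
qed

lemma curve_series_vector_derivative:
  fixes q :: "real \<Rightarrow> 'a::euclidean_space"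
  assumes "curve_series q c"
  shows "vector_derivative q (at 0) = c 1"
proof -
  have "((\<lambda>t. q t \<bullet> b) has_field_derivative c 1 \<bullet> b) (at 0)" for b
    using fps_expansion_has_derivative_at_0[OF curve_series_imp_fps_expansion[OF
        curve_series_bounded_linear[OF bounded_linear_inner_left assms]]] by simp
  then have "(q has_vector_derivative c 1) (at 0)"
    unfolding has_vector_derivative_def has_derivative_componentwise_within[of q]
    by (simp add: has_field_derivative_def mult_commute_abs mult.commute)
  then show ?thesis by (rule vector_derivative_at)
qed

section \<open>Gradients and Taylor coefficients of the length and pinning functions\<close>

text \<open>
  In a Euclidean space a derivative \<open>L\<close> is always represented by a vector, namely
  \<open>\<Sum>b. L b *\<^sub>R b\<close>, so the definite description of the gradient can be evaluated.
\<close>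

lemma inner_gradient:
  fixes f :: "'a::euclidean_space \<Rightarrow> real"
  assumes "(f has_derivative L) (at x)"
  shows "gradient f x \<bullet> h = L h"
proof -
  have lin: "linear L" using assms by (rule has_derivative_linear)
  have L: "L h = h \<bullet> (\<Sum>b\<in>Basis. L b *\<^sub>R b)" for h
  proof -
    have "L h = L (\<Sum>b\<in>Basis. (h \<bullet> b) *\<^sub>R b)" by (simp add: euclidean_representation)
    also have "\<dots> = (\<Sum>b\<in>Basis. (h \<bullet> b) * L b)"
      by (simp add: linear_sum[OF lin] linear_cmul[OF lin])
    finally show ?thesis by (simp add: inner_sum_right mult.commute)
  qed
  have "GDERIV f x :> (\<Sum>b\<in>Basis. L b *\<^sub>R b)"
    using assms unfolding gderiv_def by (metis (no_types, lifting) L ext)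
  moreover have "g = g'" if "GDERIV f x :> g" "GDERIV f x :> g'" for g g'
  proof -
    have "(\<lambda>h. h \<bullet> g) = (\<lambda>h. h \<bullet> g')"
      using that unfolding gderiv_def by (rule has_derivative_unique)
    then show ?thesis by (metis vector_eq_ldot)
  qed
  ultimately have "gradient f x = (\<Sum>b\<in>Basis. L b *\<^sub>R b)"
    unfolding gradient_def by blast
  then show ?thesis by (metis L inner_commute)
qed

definition edge_vector :: "'n::finite \<times> 'n \<Rightarrow> ('n, 'd::finite) config \<Rightarrow> real^'d" where
  "edge_vector e x = x $ fst e - x $ snd e"

lemma bounded_linear_edge_vector: "bounded_linear (edge_vector e)"
  unfolding edge_vector_def
  by (intro bounded_linear_sub bounded_linear_vec_nth)

lemma edge_length_sq_has_derivative:
  fixes x :: "('n::finite, 'd::finite) config"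
  shows
  "(edge_length_sq e has_derivative (\<lambda>h. 2 * (edge_vector e x \<bullet> edge_vector e h))) (at x)"
proof -
  have "(edge_vector e has_derivative edge_vector e) (at x)"
    by (rule bounded_linear_imp_has_derivative[OF bounded_linear_edge_vector])
  from has_derivative_inner[OF this this]
  have "((\<lambda>x. edge_vector e x \<bullet> edge_vector e x) has_derivative
      (\<lambda>h. 2 * (edge_vector e x \<bullet> edge_vector e h))) (at x)"
    by (simp add: inner_commute)
  moreover have "edge_length_sq e = (\<lambda>x::('n, 'd) config. edge_vector e x \<bullet> edge_vector e x)"
    by (auto simp: edge_length_sq_def edge_vector_def power2_norm_eq_inner)
  ultimately show ?thesis by simp
qed

lemma rigidity_row_inner:
  "rigidity_row E x i \<bullet> h = 2 * (edge_vector (E ! (i - 1)) x \<bullet> edge_vector (E ! (i - 1)) h)"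
  unfolding rigidity_row_def by (rule inner_gradient[OF edge_length_sq_has_derivative])

text \<open>
  The symmetric bilinear form \<open>Q\<^sub>i\<close> with \<open>f\<^sub>i(x + h) = f\<^sub>i(x) + \<nabla>f\<^sub>i(x) \<bullet> h + Q\<^sub>i(h, h)\<close>, which is zero
  for the linear pinning functions.
\<close>

definition quadratic_part :: "('n::finite \<times> 'n) list \<Rightarrow> nat
    \<Rightarrow> ('n, 'd::finite) config \<Rightarrow> ('n, 'd) config \<Rightarrow> real" where
  "quadratic_part E i x y =
    (if i \<le> length E then edge_vector (E ! (i - 1)) x \<bullet> edge_vector (E ! (i - 1)) y else 0)"

lemma ffun_edge: "i \<le> length E \<Longrightarrow> ffun E vtx crd i = edge_length_sq (E ! (i - 1))"
  by (auto simp: ffun_def)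

lemma ffun_pin_bounded_linear:
  fixes crd :: "nat \<Rightarrow> 'd::finite"
  assumes "\<not> i \<le> length E"
  shows "bounded_linear (ffun E vtx crd i)"
proof -
  obtain a b where "pinned_coords CARD('d) ! (i - length E - 1) = (a, b)" by fastforce
  then have "ffun E vtx crd i = (\<lambda>x. x $ vtx a $ crd b)"
    using assms by (auto simp: ffun_def)
  then show ?thesis
    by (simp add: bounded_linear_compose[OF bounded_linear_vec_nth bounded_linear_vec_nth])
qed

lemma gradient_pin_inner:
  "\<not> i \<le> length E \<Longrightarrow> gradient (ffun E vtx crd i) x \<bullet> h = ffun E vtx crd i h"
  by (intro inner_gradient bounded_linear_imp_has_derivative ffun_pin_bounded_linear)

lemma gradient_edge_inner:
  "i \<le> length E \<Longrightarrow> gradient (ffun E vtx crd i) x \<bullet> h =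
     2 * (edge_vector (E ! (i - 1)) x \<bullet> edge_vector (E ! (i - 1)) h)"
  using rigidity_row_inner[of E x i h] by (simp add: ffun_edge rigidity_row_def)

text \<open>
  The pinning functions are linear and act on the series coefficient by coefficient. For an edge
  the coefficients are those of the Cauchy product of the edge vector with itself; the terms
  that contain the constant coefficient make up the gradient part.
\<close>

lemma ffun_along_curve:
  fixes q :: "real \<Rightarrow> ('n::finite, 'd::finite) config"
  assumes "curve_series q c"
  obtains F where "(\<lambda>t. ffun E vtx crd i (q t)) has_fps_expansion F"
    "fps_nth F 1 = gradient (ffun E vtx crd i) (q 0) \<bullet> c 1"
    "fps_nth F 2 = gradient (ffun E vtx crd i) (q 0) \<bullet> c 2 + quadratic_part E i (c 1) (c 1)"
    "fps_nth F 3 = gradient (ffun E vtx crd i) (q 0) \<bullet> c 3 + 2 * quadratic_part E i (c 1) (c 2)"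
proof (cases "i \<le> length E")
  case True
  let ?e = "edge_vector (E ! (i - 1))"
  have "(\<lambda>t. ?e (q t) \<bullet> ?e (q t)) has_fps_expansion
      Abs_fps (\<lambda>k. \<Sum>j\<le>k. ?e (c j) \<bullet> ?e (c (k - j)))"
    by (intro curve_series_inner_self curve_series_bounded_linear[OF bounded_linear_edge_vector] assms)
  moreover have "?e x \<bullet> ?e x = ffun E vtx crd i x" for x
    using True by (simp add: ffun_edge edge_length_sq_def edge_vector_def power2_norm_eq_inner)
  moreover
  let ?F = "Abs_fps (\<lambda>k. \<Sum>j\<le>k. ?e (c j) \<bullet> ?e (c (k - j)))"
  have "fps_nth ?F 1 = 2 * (?e (c 0) \<bullet> ?e (c 1))"
    "fps_nth ?F 2 = 2 * (?e (c 0) \<bullet> ?e (c 2)) + ?e (c 1) \<bullet> ?e (c 1)"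
    "fps_nth ?F 3 = 2 * (?e (c 0) \<bullet> ?e (c 3)) + 2 * (?e (c 1) \<bullet> ?e (c 2))"
    by (simp_all add: eval_nat_numeral inner_commute)
  ultimately show thesis
    using True curve_series_at_0[OF assms]
    by (intro that[of ?F]) (simp_all add: gradient_edge_inner quadratic_part_def)
next
  case False
  show thesis
    using False curve_series_at_0[OF assms]
    by (intro that[OF curve_series_imp_fps_expansion[OF
          curve_series_bounded_linear[OF ffun_pin_bounded_linear assms]]])
      (auto simp: gradient_pin_inner quadratic_part_def)
qed

lemma order_three_contact:
  fixes q :: "real \<Rightarrow> ('n::finite, 'd::finite) config"
  assumes "curve_series q c"
    and "(\<lambda>t. ffun E vtx crd i (q t) - ffun E vtx crd i (q 0) - a * t ^ 3) \<in> o[at 0](\<lambda>t. t ^ 3)"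
  shows "gradient (ffun E vtx crd i) (q 0) \<bullet> c 1 = 0"
    and "gradient (ffun E vtx crd i) (q 0) \<bullet> c 2 = - quadratic_part E i (c 1) (c 1)"
    and "gradient (ffun E vtx crd i) (q 0) \<bullet> c 3 + 2 * quadratic_part E i (c 1) (c 2) = a"
proof -
  obtain F where F: "(\<lambda>t. ffun E vtx crd i (q t)) has_fps_expansion F"
    "fps_nth F 1 = gradient (ffun E vtx crd i) (q 0) \<bullet> c 1"
    "fps_nth F 2 = gradient (ffun E vtx crd i) (q 0) \<bullet> c 2 + quadratic_part E i (c 1) (c 1)"
    "fps_nth F 3 = gradient (ffun E vtx crd i) (q 0) \<bullet> c 3 + 2 * quadratic_part E i (c 1) (c 2)"
    by (rule ffun_along_curve[OF assms(1)])
  define H where "H = F - fps_const (ffun E vtx crd i (q 0)) - fps_const a * fps_X ^ 3"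
  have "(\<lambda>t. ffun E vtx crd i (q t) - ffun E vtx crd i (q 0) - a * t ^ 3) has_fps_expansion H"
    unfolding H_def by (intro fps_expansion_intros F(1))
  from fps_nth_eq_0_if_smallo[OF this assms(2)] have "fps_nth H k = 0" if "k \<le> 3" for k
    using that .
  from this[of 1] this[of 2] this[of 3] show
    "gradient (ffun E vtx crd i) (q 0) \<bullet> c 1 = 0"
    "gradient (ffun E vtx crd i) (q 0) \<bullet> c 2 = - quadratic_part E i (c 1) (c 1)"
    "gradient (ffun E vtx crd i) (q 0) \<bullet> c 3 + 2 * quadratic_part E i (c 1) (c 2) = a"
    using F(2-4) by (simp_all add: H_def fps_X_power_nth)
qed

lemma higher_deriv_ffun_along_curve:
  fixes q :: "real \<Rightarrow> ('n::finite, 'd::finite) config" and E :: "('n \<times> 'n) list"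
    and vtx :: "nat \<Rightarrow> 'n" and crd :: "nat \<Rightarrow> 'd" and i :: nat
  assumes "curve_series q c"
  defines "f \<equiv> (\<lambda>t. ffun E vtx crd i (q t))" and "g \<equiv> gradient (ffun E vtx crd i) (q 0)"
  shows "(deriv ^^ 1) f 0 = g \<bullet> c 1"
    and "(deriv ^^ 2) f 0 = 2 * (g \<bullet> c 2 + quadratic_part E i (c 1) (c 1))"
    and "(deriv ^^ 3) f 0 = 6 * (g \<bullet> c 3 + 2 * quadratic_part E i (c 1) (c 2))"
proof -
  obtain F where F: "f has_fps_expansion F"
    "fps_nth F 1 = g \<bullet> c 1"
    "fps_nth F 2 = g \<bullet> c 2 + quadratic_part E i (c 1) (c 1)"
    "fps_nth F 3 = g \<bullet> c 3 + 2 * quadratic_part E i (c 1) (c 2)"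
    unfolding f_def g_def by (rule ffun_along_curve[OF assms(1)])
  have fact: "fact 1 = (1::real)" "fact 2 = (2::real)" "fact 3 = (6::real)"
    by (simp_all add: fact_numeral)
  show "(deriv ^^ 1) f 0 = g \<bullet> c 1"
    "(deriv ^^ 2) f 0 = 2 * (g \<bullet> c 2 + quadratic_part E i (c 1) (c 1))"
    "(deriv ^^ 3) f 0 = 6 * (g \<bullet> c 3 + 2 * quadratic_part E i (c 1) (c 2))"
    unfolding higher_deriv_fps_expansion[OF F(1)] fact F(2-4) by simp_all
qed

section \<open>Pins exclude the trivial flexes\<close>

lemma pins_vanish_imp_pinned:
  fixes crd :: "nat \<Rightarrow> 'd::finite"
  assumes "\<forall>k\<in>{1..D_of CARD('d)}. ffun E vtx crd (length E + k) x = 0"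
    and "1 \<le> i" "i \<le> j" "j \<le> CARD('d)"
  shows "x $ vtx i $ crd j = 0"
proof -
  have "(i, j) \<in> set (pinned_coords CARD('d))"
    using assms(2-4) by (simp add: set_pinned_coords)
  then obtain k where k: "k < D_of CARD('d)" "pinned_coords CARD('d) ! k = (i, j)"
    by (metis in_set_conv_nth length_pinned_coords)
  then have "ffun E vtx crd (length E + Suc k) x = 0"
    using assms(1) by (intro bspec[OF assms(1)]) auto
  then show ?thesis using k(2) by (simp add: ffun_def)
qed

text \<open>
  Write \<open>v\<^sub>i = A p\<^sub>i + b\<close> and let \<open>W\<^sub>k\<close> be the span of the first \<open>k\<close> coordinate vectors. The first
  vertex is fixed at the origin, so \<open>b = 0\<close>. By affine independence and a dimension count,
  \<open>p\<^sub>2, \<dots>, p\<^sub>k\<^sub>+\<^sub>1\<close> is a basis of \<open>W\<^sub>k\<close> for \<open>k < d\<close>, and the pins on \<open>v\<close> put the images \<open>A p\<^sub>i\<close> into \<open>W\<^sub>k\<close>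
  as well. So \<open>A\<close> preserves the whole flag, that is, \<open>A\<close> is upper triangular, and a
  skew-symmetric upper triangular matrix is zero.
\<close>

lemma pinned_trivial_flex_eq_0:
  fixes p v :: "('n::finite, 'd::finite) config"
  assumes fw: "pinned_framework E vtx crd p" and triv: "v \<in> trivial_flexes p"
    and v_pin: "\<forall>k\<in>{1..D_of CARD('d)}. ffun E vtx crd (length E + k) v = 0"
  shows "v = 0"
proof -
  let ?d = "CARD('d)" and ?P = "\<lambda>k. (\<lambda>i. p $ vtx i) ` {2..Suc k}"
  define W where "W k = {x::real^'d. \<forall>j\<in>{k<..?d}. x $ crd j = 0}" for k
  have crd: "bij_betw crd {1..?d} UNIV"
    and inj: "inj_on (\<lambda>i. p $ vtx i) {1..?d + 1}"
    and aff: "\<not> affine_dependent ((\<lambda>i. p $ vtx i) ` {1..?d + 1})"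
    and p_pin: "\<forall>k\<in>{1..D_of ?d}. ffun E vtx crd (length E + k) p = 0"
    using fw by (simp_all add: pinned_framework_def)
  obtain A :: "real^'d^'d" and b where skew: "transpose A = - A" and v: "\<And>i. v $ i = A *v (p $ i) + b"
    using triv by (auto simp: trivial_flexes_def)
  have crd_ex: "\<exists>j\<in>{1..?d}. l = crd j" for l
    using crd unfolding bij_betw_def by (metis UNIV_I imageE)
  have p1: "p $ vtx 1 = 0" and v1: "v $ vtx 1 = 0"
    using pins_vanish_imp_pinned[OF p_pin, of 1] pins_vanish_imp_pinned[OF v_pin, of 1] crd_ex
    by (metis (no_types) atLeastAtMost_iff order_refl vec_eq_iff zero_index)+
  have b: "b = 0" using v[of "vtx 1"] p1 v1 by simp

  have ind: "independent (?P ?d)"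
  proof -
    have "{1..?d + 1} = insert 1 {2..Suc ?d}" by auto
    then have "\<not> affine_dependent (insert 0 (?P ?d))"
      using aff p1 by (metis image_insert)
    moreover have "0 \<notin> ?P ?d"
      using inj_onD[OF inj, of 1] p1 by force
    ultimately show ?thesis by (simp add: affine_dependent_iff_dependent)
  qed
  have span_P: "span (?P k) = W k" if "k < ?d" for k
  proof -
    have sub: "?P k \<subseteq> W k"
      using that by (auto simp: W_def intro!: pins_vanish_imp_pinned[OF p_pin])
    have "independent (?P k)"
      using that by (intro independent_mono[OF ind] image_mono) auto
    moreover have "card (?P k) = k"
      using that by (subst card_image) (auto intro: inj_on_subset[OF inj])
    moreover have "dim (W k) = k"
    proof -
      have "{k<..?d} = {1..?d} - {1..k}" by auto
      then have "crd ` {k<..?d} = - crd ` {1..k}"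
        using that crd inj_on_image_set_diff[of crd "{1..?d}" "{1..?d}" "{1..k}"]
        by (auto simp: bij_betw_def Compl_eq_Diff_UNIV)
      moreover have "W k = {x. \<forall>l\<in>crd ` {k<..?d}. x $ l = 0}"
        by (auto simp: W_def)
      ultimately have "W k = {x. \<forall>l. l \<notin> crd ` {1..k} \<longrightarrow> x $ l = 0}"
        by (simp add: Ball_def)
      moreover have "card (crd ` {1..k}) = k"
        using that crd by (subst card_image) (auto simp: bij_betw_def intro: inj_on_subset)
      ultimately show ?thesis
        using dim_substandard_cart[of "crd ` {1..k}", where 'a = real] by (simp add: dim_vec_eq)
    qed
    moreover have "subspace (W k)"
      by (auto simp: W_def subspace_def)
    moreover from this have "span (?P k) \<subseteq> W k"
      using sub by (intro span_minimal)
    ultimately show ?thesis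
      by (intro subspace_dim_equal) (auto simp: dim_eq_card_independent)
  qed
  have A_W: "A *v x \<in> W k" if "k < ?d" "x \<in> W k" for x k
  proof -
    have "A *v x \<in> span ((*v) A ` ?P k)"
      using that span_P[of k] linear_span_image[OF matrix_vector_mul_linear, of A "?P k"] by auto
    moreover have "(*v) A ` ?P k \<subseteq> W k"
    proof safe
      fix i assume "i \<in> {2..Suc k}"
      then have "v $ vtx i \<in> W k"
        using that(1) by (auto simp: W_def intro!: pins_vanish_imp_pinned[OF v_pin])
      then show "A *v p $ vtx i \<in> W k" using v b by simp
    qed
    moreover have "subspace (W k)"
      by (auto simp: W_def subspace_def)
    ultimately show ?thesis using span_minimal by blast
  qed
  have upper: "A $ crd j $ crd i = 0" if "1 \<le> i" "i < j" "j \<le> ?d" for i j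
  proof -
    have "axis (crd i) 1 \<in> W i"
      using that crd by (auto simp: W_def axis_def bij_betw_def dest: inj_onD)
    then have "A *v axis (crd i) 1 \<in> W i"
      using that by (intro A_W) auto
    then show ?thesis
      using that by (simp add: W_def matrix_vector_mul_component column_def
          matrix_vector_mult_basis)
  qed
  have skew': "A $ k $ l = - A $ l $ k" for k l
    using arg_cong[OF skew, of "\<lambda>M. M $ l $ k"] by (simp add: transpose_def)
  have "A $ k $ l = 0" for k l
  proof -
    obtain i j where "k = crd i" "l = crd j" "i \<in> {1..?d}" "j \<in> {1..?d}"
      using crd_ex by metis
    then show ?thesis
      using upper[of i j] upper[of j i] skew'[of k l] by (cases i j rule: linorder_cases) auto
  qed
  then have "A = 0" by (simp add: vec_eq_iff)
  then have "v $ i = 0" for i using v b by simp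
  then show ?thesis by (simp add: vec_eq_iff)
qed

section \<open>The line of first-order flexes\<close>

lemma orthogonal_complement_eq_span:
  fixes g :: "'i \<Rightarrow> 'a::euclidean_space"
  assumes "inj_on g I" "independent (g ` I)" "Suc (card I) = DIM('a)"
    and "v \<noteq> 0" "\<And>i. i \<in> I \<Longrightarrow> g i \<bullet> v = 0"
  shows "{x. \<forall>i\<in>I. g i \<bullet> x = 0} = span {v}"
proof -
  let ?K = "{x. \<forall>i\<in>I. g i \<bullet> x = 0}"
  have "{y \<in> UNIV. \<forall>x\<in>span (g ` I). orthogonal x y} = ?K"
  proof (intro set_eqI iffI)
    fix y assume "y \<in> {y \<in> UNIV. \<forall>x\<in>span (g ` I). orthogonal x y}"
    then show "y \<in> ?K" by (auto simp: orthogonal_def span_base)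
  next
    fix y assume "y \<in> ?K"
    then have "orthogonal y x" if "x \<in> span (g ` I)" for x
      using that by (intro orthogonal_to_span[of x "g ` I"]) (auto simp: orthogonal_def inner_commute)
    then show "y \<in> {y \<in> UNIV. \<forall>x\<in>span (g ` I). orthogonal x y}"
      by (simp add: orthogonal_commute)
  qed
  then have "dim ?K + dim (g ` I) = DIM('a)"
    using dim_subspace_orthogonal_to_vectors[of "span (g ` I)" "UNIV::'a set"] by simp
  moreover have "dim (g ` I) = card I"
    using assms by (simp add: dim_eq_card_independent card_image)
  ultimately have "dim ?K = 1" using assms(3) by simp
  moreover have "dim {v} = 1"
    using assms(4) by (simp add: dim_eq_card_independent)
  moreover have "subspace ?K"
    by (auto simp: subspace_def inner_add_right)
  moreover from this have "span {v} \<subseteq> ?K"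
    using assms(5) by (intro span_minimal) auto
  ultimately have "span {v} = ?K"
    by (intro subspace_dim_equal) auto
  then show ?thesis by simp
qed

section \<open>Second-order flexibility and third-order rigidity\<close>

theorem theorem5p4:
  fixes E :: "('n::finite \<times> 'n) list"
    and vtx :: "nat \<Rightarrow> 'n" and crd :: "nat \<Rightarrow> 'd::finite"
    and p :: "('n, 'd) config" and q :: "real \<Rightarrow> ('n, 'd) config"
    and \<epsilon> a3 :: real
  assumes "pinned_framework E vtx crd p"
    and "isostatic E p"
    and "inj_on (\<lambda>i. gradient (ffun E vtx crd i) p) {2..length E + D_of CARD('d)}"
    and "independent ((\<lambda>i. gradient (ffun E vtx crd i) p) ` {2..length E + D_of CARD('d)})"
    and "\<epsilon> > 0" and "real_analytic_on {-\<epsilon><..<\<epsilon>} q"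
    and "q 0 = p" and "vector_derivative q (at 0) \<noteq> 0"
    and "\<forall>t\<in>{-\<epsilon><..<\<epsilon>}. \<forall>i\<in>{2..length E + D_of CARD('d)}.
           ffun E vtx crd i (q t) = ffun E vtx crd i p"
    and "(\<lambda>t. ffun E vtx crd 1 (q t) - ffun E vtx crd 1 p - a3 * t ^ 3) \<in> o[at 0](\<lambda>t. t ^ 3)"
  shows "\<not> second_order_rigid E p \<and> (a3 \<noteq> 0 \<longrightarrow> third_order_rigid E vtx crd p)"
proof -
  let ?N = "length E + D_of CARD('d)"
  define g where "g i = gradient (ffun E vtx crd i) p" for i
  define Q where "Q = (quadratic_part E :: nat \<Rightarrow> ('n, 'd) config \<Rightarrow> _)"
  obtain c where c: "curve_series q c"
    using real_analytic_on_curve_series[OF assms(6)] assms(5) by auto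
  have c1: "c 1 \<noteq> 0"
    using curve_series_vector_derivative[OF c] assms(8) by simp

  have contact: "(\<lambda>t. ffun E vtx crd i (q t) - ffun E vtx crd i (q 0)
      - (if i = 1 then a3 else 0) * t ^ 3) \<in> o[at 0](\<lambda>t. t ^ 3)" if "i \<in> {1..?N}" for i
  proof (cases "i = 1")
    case True
    then show ?thesis using assms(7,10) by simp
  next
    case False
    have "eventually (\<lambda>t. t \<in> {-\<epsilon><..<\<epsilon>}) (at 0)"
      using assms(5) by (intro eventually_at_in_open') auto
    then have "eventually (\<lambda>t. ffun E vtx crd i (q t) - ffun E vtx crd i (q 0)
        - (if i = 1 then a3 else 0) * t ^ 3 = 0) (at 0)"
      by eventually_elim (use False that assms(7,9) in auto)
    from landau_o.small.in_cong[OF this, of "\<lambda>t. t ^ 3"] show ?thesis by simp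
  qed
  have g1: "g i \<bullet> c 1 = 0" and g2: "g i \<bullet> c 2 = - Q i (c 1) (c 1)"
    and g3: "g i \<bullet> c 3 + 2 * Q i (c 1) (c 2) = (if i = 1 then a3 else 0)" if "i \<in> {1..?N}" for i
    using order_three_contact[OF c contact[OF that]] assms(7) by (simp_all add: g_def Q_def)

  have "\<not> second_order_rigid E p"
  proof -
    have "c 1 \<notin> trivial_flexes p"
    proof
      assume "c 1 \<in> trivial_flexes p"
      moreover have "\<forall>k\<in>{1..D_of CARD('d)}. ffun E vtx crd (length E + k) (c 1) = 0"
      proof
        fix k assume "k \<in> {1..D_of CARD('d)}"
        then show "ffun E vtx crd (length E + k) (c 1) = 0"
          using g1[of "length E + k"] by (simp add: g_def gradient_pin_inner)
      qed
      ultimately show False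
        using pinned_trivial_flex_eq_0[OF assms(1)] c1 by blast
    qed
    (* The factor 2 appears because a is the second derivative, twice the coefficient c 2. *)
    moreover have "rigidity_row E p i \<bullet> c 1 = 0"
      "rigidity_row E p i \<bullet> (2 *\<^sub>R c 2) = - (rigidity_row E (c 1) i \<bullet> c 1)"
      if "i \<in> {1..length E}" for i
    proof -
      have *: "rigidity_row E p i = g i"
        using that by (simp add: g_def ffun_edge rigidity_row_def)
      have "i \<in> {1..?N}" using that by auto
      then show "rigidity_row E p i \<bullet> c 1 = 0"
        "rigidity_row E p i \<bullet> (2 *\<^sub>R c 2) = - (rigidity_row E (c 1) i \<bullet> c 1)"
        using that g1 g2 unfolding * rigidity_row_inner by (simp_all add: Q_def quadratic_part_def)
    qed
    ultimately show ?thesis unfolding second_order_rigid_def by blast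
  qed
  moreover have "third_order_rigid E vtx crd p" if "a3 \<noteq> 0"
  proof -
    have N: "?N = DIM(('n, 'd) config)"
      using assms(2) by (simp add: isostatic_def)
    have line: "{x. \<forall>i\<in>{2..?N}. g i \<bullet> x = 0} = span {c 1}"
      using assms(3,4) c1 g1 N unfolding g_def[symmetric]
      by (intro orthogonal_complement_eq_span) auto
    have "Kspace E vtx crd p = span {c 1}"
    proof
      show "Kspace E vtx crd p \<subseteq> span {c 1}"
        unfolding line[symmetric] by (auto simp: Kspace_def g_def)
      show "span {c 1} \<subseteq> Kspace E vtx crd p"
        using g1 by (auto simp: Kspace_def g_def span_singleton)
    qed
    then have "dim (Kspace E vtx crd p) = 1"
      using c1 by (simp add: dim_eq_card_independent)
    moreover have "flex_1k E vtx crd p 2 q"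
      unfolding flex_1k_def
    proof (intro conjI ballI)
      fix j i assume j: "j \<in> {1..2::nat}" and i: "i \<in> {1..?N}"
      then have "j = 1 \<or> j = 2" by auto
      then show "(deriv ^^ j) (\<lambda>t. ffun E vtx crd i (q t)) 0 = 0"
        using higher_deriv_ffun_along_curve[OF c, of E vtx crd i] g1[OF i] g2[OF i] assms(7)
        by (auto simp: g_def Q_def simp del: funpow.simps One_nat_def)
    qed (use assms in auto)
    moreover have "\<not> flex_1k E vtx crd p 3 r" for r
    proof
      assume r: "flex_1k E vtx crd p 3 r"
      then obtain \<delta> where "\<delta> > 0" "real_analytic_on {-\<delta><..<\<delta>} r"
        by (auto simp: flex_1k_def)
      then obtain e where e: "curve_series r e"
        using real_analytic_on_curve_series[of "{-\<delta><..<\<delta>}" r] by auto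
      have "r 0 = p" and e1: "e 1 \<noteq> 0"
        using r curve_series_vector_derivative[OF e] by (auto simp: flex_1k_def)
      have h1: "g i \<bullet> e 1 = 0" and h2: "g i \<bullet> e 2 = - Q i (e 1) (e 1)"
        and h3: "g i \<bullet> e 3 = - 2 * Q i (e 1) (e 2)" if "i \<in> {1..?N}" for i
      proof -
        have "(deriv ^^ j) (\<lambda>t. ffun E vtx crd i (r t)) 0 = 0" if "j \<in> {1..3}" for j
          using r that \<open>i \<in> {1..?N}\<close> by (simp add: flex_1k_def)
        from this[of 1] this[of 2] this[of 3] show
          "g i \<bullet> e 1 = 0" "g i \<bullet> e 2 = - Q i (e 1) (e 1)" "g i \<bullet> e 3 = - 2 * Q i (e 1) (e 2)"
          unfolding higher_deriv_ffun_along_curve[OF e] \<open>r 0 = p\<close>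
          by (simp_all add: g_def Q_def)
      qed
      have on_line: "\<exists>l. x = l *\<^sub>R c 1" if "\<And>i. i \<in> {2..?N} \<Longrightarrow> g i \<bullet> x = 0" for x
        using that line by (auto simp: span_singleton set_eq_iff)
      (* l and m are the coefficients of the reparametrisation l t + m t^2 of q
         that makes it agree with r up to order two. *)
      obtain l where l: "e 1 = l *\<^sub>R c 1"
        using on_line[of "e 1"] h1 by auto
      have Q_scale: "Q i (x *\<^sub>R u) w = x * Q i u w" "Q i w (x *\<^sub>R u) = x * Q i w u"
        "Q i w (u + u') = Q i w u + Q i w u'" for i x u u' w
        by (simp_all add: Q_def quadratic_part_def edge_vector_def inner_add_right
            algebra_simps flip: scaleR_diff_right)
      have "\<exists>m. e 2 - l\<^sup>2 *\<^sub>R c 2 = m *\<^sub>R c 1"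
        using h2 g2 by (intro on_line) (simp add: inner_diff_right l Q_scale power2_eq_square del: One_nat_def)
      then obtain m where m: "e 2 = l\<^sup>2 *\<^sub>R c 2 + m *\<^sub>R c 1"
        by (metis diff_eq_eq add.commute)
      (* The cubic coefficient of r minus that of the reparametrised q. *)
      define y where "y = e 3 - l ^ 3 *\<^sub>R c 3 - (2 * l * m) *\<^sub>R c 2"
      have y: "g i \<bullet> y = - (l ^ 3 * (if i = 1 then a3 else 0))" if "i \<in> {1..?N}" for i
      proof -
        have "g i \<bullet> y = - (l ^ 3 * (g i \<bullet> c 3 + 2 * Q i (c 1) (c 2)))"
          using h3[OF that] g2[OF that]
          by (simp add: y_def inner_diff_right l m Q_scale algebra_simps power2_eq_square power3_eq_cube
              del: One_nat_def)
        then show ?thesis using g3[OF that] by simp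
      qed
      have one: "1 \<in> {1..?N}" using N by (simp add: Suc_le_eq)
      obtain k where "y = k *\<^sub>R c 1"
        using on_line[of y] y by auto
      then have "l ^ 3 * a3 = 0" using y[OF one] g1[OF one] by simp
      then show False using that e1 l by simp
    qed
    ultimately show ?thesis unfolding third_order_rigid_def by blast
  qed
  ultimately show ?thesis by blast
qed

end
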